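(* Let $\mathcal{C}=\mathcal{C}(O,R)$ and $\mathcal{E}=\mathcal{E}(N,\frac{R}{2})$ be two circles in the Euclidean plane, with centers $O$, $N$ and radii $R>0$, $\frac{R}{2}$ respectively, such that $0\le ON<\frac{3}{2}R$. Then there exist infinitely many triangles whose circumcircle is $\mathcal{C}$ and whose Euler circle is $\mathcal{E}$. Further: (i) if $ON<\frac{R}{2}$, then all these triangles are acute; (ii) if $ON=\frac{R}{2}$, then all these triangles are right-angled; (iii) if $ON>\frac{R}{2}$, then all these triangles are obtuse.
   Context: The Euler circle (nine-point circle) of a triangle is the circle through the midpoints of its three sides. $ON$ denotes the distance between $O$ and $N$. *)

theory Defs
  imports "HOL-Analysis.Analysis"
begin

type_synonym point = "real ^ 2"

definition circle :: "point set \<Rightarrow> bool" where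
  "circle K \<longleftrightarrow> (\<exists>c r. r > 0 \<and> K = sphere c r)"

text \<open>A triangle is represented by its unordered set of vertices, so that permuting the
  vertices does not produce a different triangle.\<close>

definition triangle :: "point set \<Rightarrow> bool" where
  "triangle T \<longleftrightarrow> card T = 3 \<and> \<not> collinear T"

text \<open>Three non-collinear points lie on exactly one circle, so for a triangle each of the
  following two predicates holds for exactly one \<open>K\<close>.\<close>

definition is_circumcircle :: "point set \<Rightarrow> point set \<Rightarrow> bool" where
  "is_circumcircle K T \<longleftrightarrow> circle K \<and> T \<subseteq> K"

definition is_euler_circle :: "point set \<Rightarrow> point set \<Rightarrow> bool" where
  "is_euler_circle K T \<longleftrightarrow>
     circle K \<and> (\<forall>A\<in>T. \<forall>B\<in>T. A \<noteq> B \<longrightarrow> midpoint A B \<in> K)"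

text \<open>The unoriented angle at the middle argument \<open>A\<close>, meaningful for \<open>A \<noteq> B\<close>, \<open>A \<noteq> C\<close>.\<close>

definition angle_at :: "point \<Rightarrow> point \<Rightarrow> point \<Rightarrow> real" where
  "angle_at B A C = arccos (((B - A) \<bullet> (C - A)) / (norm (B - A) * norm (C - A)))"

definition interior_angles :: "point set \<Rightarrow> real set" where
  "interior_angles T =
     {angle_at B A C | A B C. A \<in> T \<and> B \<in> T \<and> C \<in> T \<and> A \<noteq> B \<and> A \<noteq> C \<and> B \<noteq> C}"

definition acute_triangle :: "point set \<Rightarrow> bool" where
  "acute_triangle T \<longleftrightarrow> triangle T \<and> (\<forall>\<alpha>\<in>interior_angles T. \<alpha> < pi / 2)"

definition right_triangle :: "point set \<Rightarrow> bool" where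
  "right_triangle T \<longleftrightarrow> triangle T \<and> (\<exists>\<alpha>\<in>interior_angles T. \<alpha> = pi / 2)"

definition obtuse_triangle :: "point set \<Rightarrow> bool" where
  "obtuse_triangle T \<longleftrightarrow> triangle T \<and> (\<exists>\<alpha>\<in>interior_angles T. \<alpha> > pi / 2)"

definition triangles_with :: "point set \<Rightarrow> point set \<Rightarrow> point set set" where
  "triangles_with K E = {T. triangle T \<and> is_circumcircle K T \<and> is_euler_circle E T}"

end

theory Submission
  imports Defs
begin

text \<open>With the circumcentre as origin, the centre of the Euler circle of a triangle \<open>a\<close>, \<open>b\<close>, \<open>c\<close> is
  \<open>(a + b + c) / 2\<close>, so the triangles in question are those inscribed in the circle of radius \<open>R\<close>
  with \<open>a + b + c = h\<close>, where \<open>h = 2 (N - O)\<close> is the orthocentre. A vertex \<open>a\<close> extends to such a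
  triangle as soon as \<open>h - a\<close> is a non-zero vector shorter than a diameter (one degenerate position
  excepted), and as \<open>norm h < 3 R\<close> this holds for infinitely many \<open>a\<close> close to the direction
  of \<open>h\<close>. The type of the triangle is read off the identity
  \<open>OH\<^sup>2 = R\<^sup>2 (1 - 8 cos A cos B cos C)\<close>, since at most one of the angles is not acute.\<close>

section \<open>Angles\<close>

lemma angle_at_cases:
  assumes "B \<noteq> A" "C \<noteq> A"
  shows angle_at_less: "(B - A) \<bullet> (C - A) > 0 \<Longrightarrow> angle_at B A C < pi / 2"
    and angle_at_eq: "(B - A) \<bullet> (C - A) = 0 \<Longrightarrow> angle_at B A C = pi / 2"
    and angle_at_greater: "(B - A) \<bullet> (C - A) < 0 \<Longrightarrow> angle_at B A C > pi / 2"
proof -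
  define n where "n = norm (B - A) * norm (C - A)"
  define x where "x = ((B - A) \<bullet> (C - A)) / n"
  have n: "n > 0" using assms by (simp add: n_def)
  \<comment> \<open>Strict monotonicity of \<open>arccos\<close> holds on [-1, 1]; Cauchy-Schwarz
    places the quotient there.\<close>
  have "\<bar>(B - A) \<bullet> (C - A)\<bar> \<le> n" unfolding n_def by (rule Cauchy_Schwarz_ineq2)
  then have x: "\<bar>x\<bar> \<le> 1" using n by (simp add: x_def)
  have ang: "angle_at B A C = arccos x" by (simp add: angle_at_def x_def n_def)
  show "angle_at B A C < pi / 2" if "(B - A) \<bullet> (C - A) > 0"
  proof -
    have "x > 0" using that n by (simp add: x_def)
    then show ?thesis using arccos_less_mono[of x 0] x by (simp add: ang)
  qed
  show "angle_at B A C = pi / 2" if "(B - A) \<bullet> (C - A) = 0"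
    using that by (simp add: ang x_def)
  show "angle_at B A C > pi / 2" if "(B - A) \<bullet> (C - A) < 0"
  proof -
    have "x < 0" using that n by (simp add: x_def divide_neg_pos)
    then show ?thesis using arccos_less_mono[of 0 x] x by (simp add: ang)
  qed
qed

lemma interior_angles_insert3:
  assumes "A \<noteq> B" "A \<noteq> C" "B \<noteq> C"
  shows "angle_at B A C \<in> interior_angles {A, B, C}" "angle_at A B C \<in> interior_angles {A, B, C}"
    "angle_at A C B \<in> interior_angles {A, B, C}"
  unfolding interior_angles_def using assms by blast+

section \<open>The orthocentre of an inscribed triangle\<close>

text \<open>The difference of the two sides is the Gram determinant of \<open>a\<close>,
  \<open>b\<close>, \<open>c\<close>, which vanishes because three vectors in the plane are linearly
  dependent.\<close>

lemma gram_det_2_eq_0: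
  fixes a b c :: "real ^ 2"
  shows "(a \<bullet> a) * (b \<bullet> b) * (c \<bullet> c) + 2 * (b \<bullet> c) * (a \<bullet> c) * (a \<bullet> b)
    = (a \<bullet> a) * (b \<bullet> c)\<^sup>2 + (b \<bullet> b) * (a \<bullet> c)\<^sup>2 + (c \<bullet> c) * (a \<bullet> b)\<^sup>2"
  unfolding inner_vec_def sum_2 by (simp add: power2_eq_square algebra_simps)

text \<open>Since \<open>dist A B * dist A C * cos A = (b - a) \<bullet> (c - a)\<close>, this is
  \<open>OH\<^sup>2 = R\<^sup>2 (1 - 8 cos A cos B cos C)\<close> multiplied by the squares of the three sides.\<close>

lemma orthocentre_norm_identity:
  fixes a b c :: "real ^ 2"
  assumes "norm a = R" "norm b = R" "norm c = R"
  shows "(R\<^sup>2 - (norm (a + b + c))\<^sup>2) * ((norm (a - b))\<^sup>2 * (norm (b - c))\<^sup>2 * (norm (a - c))\<^sup>2)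
    = 8 * R\<^sup>2 * (((b - a) \<bullet> (c - a)) * ((a - b) \<bullet> (c - b)) * ((a - c) \<bullet> (b - c)))"
proof -
  define Q x y z where "Q = R\<^sup>2" and "x = b \<bullet> c" and "y = a \<bullet> c" and "z = a \<bullet> b"
  have sq: "a \<bullet> a = Q" "b \<bullet> b = Q" "c \<bullet> c = Q"
    using assms by (simp_all add: Q_def flip: power2_norm_eq_inner)
  have inner: "b \<bullet> c = x" "c \<bullet> b = x" "a \<bullet> c = y" "c \<bullet> a = y" "a \<bullet> b = z" "b \<bullet> a = z"
    by (simp_all add: x_def y_def z_def inner_commute)
  have n: "(norm (a + b + c))\<^sup>2 = 3 * Q + 2 * (x + y + z)" "(norm (a - b))\<^sup>2 = 2 * (Q - z)"
    "(norm (b - c))\<^sup>2 = 2 * (Q - x)" "(norm (a - c))\<^sup>2 = 2 * (Q - y)"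
    by (simp_all add: power2_norm_eq_inner inner_simps sq inner)
  have i: "(b - a) \<bullet> (c - a) = Q + x - y - z" "(a - b) \<bullet> (c - b) = Q - x + y - z"
    "(a - c) \<bullet> (b - c) = Q - x - y + z"
    by (simp_all add: inner_simps sq inner)
  have g: "Q * Q * Q + 2 * x * y * z - (Q * x\<^sup>2 + Q * y\<^sup>2 + Q * z\<^sup>2) = 0"
    using gram_det_2_eq_0[of a b c] by (simp add: sq inner)
  \<comment> \<open>The two sides of the claim differ by a multiple of the Gram determinant, which
    is 0 by \<open>g\<close>.\<close>
  have "(Q - (3 * Q + 2 * (x + y + z))) * (2 * (Q - z) * (2 * (Q - x)) * (2 * (Q - y)))
      - 8 * Q * ((Q + x - y - z) * (Q - x + y - z) * (Q - x - y + z))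
    = 8 * (x + y + z - 3 * Q) * (Q * Q * Q + 2 * x * y * z - (Q * x\<^sup>2 + Q * y\<^sup>2 + Q * z\<^sup>2))"
    by (simp add: power2_eq_square algebra_simps)
  then show ?thesis
    unfolding n i g Q_def[symmetric] by simp
qed

text \<open>Of three distinct collinear points one lies strictly between the other two, hence
  strictly nearer to \<open>P\<close> than one of them.\<close>

lemma not_collinear_sphere:
  fixes a b c :: "'a :: euclidean_space"
  assumes "dist P a = R" "dist P b = R" "dist P c = R" "a \<noteq> b" "a \<noteq> c" "b \<noteq> c"
  shows "\<not> collinear {a, b, c}"
proof
  assume "collinear {a, b, c}"
  then have "a \<in> open_segment b c \<or> b \<in> open_segment c a \<or> c \<in> open_segment a b"
    using assms(4-6) by (auto simp: collinear_between_cases between_mem_segment open_segment_def)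
  then show False
    using assms(1-3) by (auto dest!: dist_decreases_open_segment[of _ _ _ P] simp: dist_commute)
qed

text \<open>Let \<open>v\<close> be the defect \<open>2 *\<^sub>R n - (a + b + c)\<close>. Each
  midpoint condition says that adding \<open>v\<close> to the opposite vertex preserves its norm
  \<open>R\<close>, which is a linear equation for that vertex. If \<open>v\<close> were non-zero,
  all three vertices would lie on the line given by this equation.\<close>

lemma vertex_sum_eq_orthocentre:
  fixes a b c n :: "real ^ 2"
  assumes nc: "\<not> collinear {a, b, c}"
    and R: "norm a = R" "norm b = R" "norm c = R"
    and mid: "norm (n - (a + b) /\<^sub>R 2) = R / 2" "norm (n - (b + c) /\<^sub>R 2) = R / 2"
      "norm (n - (a + c) /\<^sub>R 2) = R / 2"
  shows "a + b + c = 2 *\<^sub>R n"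
proof -
  define v where "v = 2 *\<^sub>R n - (a + b + c)"
  have *: "v \<bullet> w = - (v \<bullet> v) / 2" if "v + w = 2 *\<^sub>R (n - m)" "norm w = R" "norm (n - m) = R / 2" for w m
  proof -
    have "norm (v + w) = R" using that by simp
    then have "(v + w) \<bullet> (v + w) = w \<bullet> w"
      using that(2) by (simp flip: power2_norm_eq_inner)
    then show ?thesis by (simp add: inner_simps inner_commute)
  qed
  have "v \<bullet> a = - (v \<bullet> v) / 2"
    by (rule *[OF _ R(1) mid(2)]) (simp add: v_def algebra_simps)
  moreover have "v \<bullet> b = - (v \<bullet> v) / 2"
    by (rule *[OF _ R(2) mid(3)]) (simp add: v_def algebra_simps)
  moreover have "v \<bullet> c = - (v \<bullet> v) / 2"
    by (rule *[OF _ R(3) mid(1)]) (simp add: v_def algebra_simps)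
  ultimately have sub: "{a, b, c} \<subseteq> {x. v \<bullet> x = - (v \<bullet> v) / 2}" by auto
  have "v = 0"
  proof (rule ccontr)
    assume "v \<noteq> 0"
    then have "aff_dim {x. v \<bullet> x = - (v \<bullet> v) / 2} = 1"
      by (subst aff_dim_hyperplane) auto
    then have "collinear {x. v \<bullet> x = - (v \<bullet> v) / 2}" by (simp add: collinear_aff_dim)
    then show False using nc sub collinear_subset by blast
  qed
  then show ?thesis by (simp add: v_def)
qed

text \<open>With the circumcentre moved to the origin, \<open>orthocentre_norm_identity\<close>
  equates the two arguments of \<open>sgn\<close> up to positive factors. The product on the right
  has the sign of cos A cos B cos C.\<close>

lemma sgn_triangles_with:
  assumes T: "T \<in> triangles_with (sphere P R) (sphere N (R / 2))"
    and ABC: "T = {A, B, C}" "A \<noteq> B" "A \<noteq> C" "B \<noteq> C" and "R > 0"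
  shows "sgn ((R / 2)\<^sup>2 - (dist P N)\<^sup>2)
    = sgn (((B - A) \<bullet> (C - A)) * ((A - B) \<bullet> (C - B)) * ((A - C) \<bullet> (B - C)))"
proof -
  define a b c where "a = A - P" and "b = B - P" and "c = C - P"
  have R: "norm a = R" "norm b = R" "norm c = R"
    using T by (auto simp: triangles_with_def is_circumcircle_def ABC a_def b_def c_def
        dist_norm norm_minus_commute)
  have nc: "\<not> collinear {a, b, c}"
    using R ABC by (intro not_collinear_sphere[of 0 _ R]) (auto simp: a_def b_def c_def)
  have mid: "norm ((N - P) - ((X - P) + (Y - P)) /\<^sub>R 2) = R / 2"
    if "X \<in> T" "Y \<in> T" "X \<noteq> Y" for X Y
  proof -
    have "norm (N - midpoint X Y) = R / 2"
      using T that by (auto simp: triangles_with_def is_euler_circle_def dist_norm)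
    moreover have "N - midpoint X Y = (N - P) - ((X - P) + (Y - P)) /\<^sub>R 2"
      by (simp add: midpoint_def vec_eq_iff field_simps)
    ultimately show ?thesis by simp
  qed
  have "a + b + c = 2 *\<^sub>R (N - P)"
    using vertex_sum_eq_orthocentre[OF nc R, of "N - P"] mid ABC
    by (simp add: a_def b_def c_def)
  then have h: "(norm (a + b + c))\<^sup>2 = 4 * (dist P N)\<^sup>2"
    by (simp add: dist_norm norm_minus_commute power_mult_distrib)
  define S where "S = (norm (a - b))\<^sup>2 * (norm (b - c))\<^sup>2 * (norm (a - c))\<^sup>2"
  have S: "S > 0" using ABC by (simp add: S_def a_def b_def c_def)
  define p where "p = ((B - A) \<bullet> (C - A)) * ((A - B) \<bullet> (C - B)) * ((A - C) \<bullet> (B - C))"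
  have "(R\<^sup>2 - (norm (a + b + c))\<^sup>2) * S = 8 * R\<^sup>2 * p"
    using orthocentre_norm_identity[OF R] by (simp add: S_def p_def a_def b_def c_def)
  then have "(4 * S) * ((R / 2)\<^sup>2 - (dist P N)\<^sup>2) = (8 * R\<^sup>2) * p"
    unfolding h by (simp add: field_simps)
  then have "sgn ((4 * S) * ((R / 2)\<^sup>2 - (dist P N)\<^sup>2)) = sgn ((8 * R\<^sup>2) * p)" by (rule arg_cong)
  then show ?thesis using S \<open>R > 0\<close> by (simp add: sgn_mult p_def)
qed

section \<open>Existence\<close>

definition perp :: "real ^ 2 \<Rightarrow> real ^ 2" where
  "perp v = vector [- (v $ 2), v $ 1]"

lemma inner_perp [simp]: "v \<bullet> perp v = 0" "perp v \<bullet> v = 0"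
  by (simp_all add: perp_def inner_vec_def sum_2)

lemma inner_perp_perp: "perp v \<bullet> perp v = v \<bullet> v"
  by (simp add: perp_def inner_vec_def sum_2)

lemma norm_add_perp: "(norm (s *\<^sub>R v + t *\<^sub>R perp v))\<^sup>2 = (s\<^sup>2 + t\<^sup>2) * (norm v)\<^sup>2"
  using inner_perp_perp[of v] unfolding power2_norm_eq_inner
  by (simp add: inner_simps power2_eq_square algebra_simps)

text \<open>The points are the ends of the chord with midpoint \<open>d / 2\<close>, which lies
  inside the circle. They are \<open>d / 2\<close> plus and minus \<open>s *\<^sub>R perp d\<close>,
  where Pythagoras demands
  \<open>(1 / 4 + s\<^sup>2) * (norm d)\<^sup>2 = R\<^sup>2\<close>.\<close>

lemma chord_with_sum:
  fixes d :: "real ^ 2"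
  assumes "d \<noteq> 0" "norm d < 2 * R"
  obtains b c where "norm b = R" "norm c = R" "b + c = d" "b \<noteq> c"
proof -
  define s where "s = sqrt ((R / norm d)\<^sup>2 - 1 / 4)"
  have "1 / 2 < R / norm d" using assms by (simp add: field_simps)
  then have "(1 / 2)\<^sup>2 < (R / norm d)\<^sup>2" by (rule power_strict_mono) auto
  then have s: "s > 0" "s\<^sup>2 = (R / norm d)\<^sup>2 - 1 / 4"
    by (simp_all add: s_def power2_eq_square)
  have R: "R \<ge> 0" using assms norm_ge_zero[of d] by linarith
  have n: "norm ((1 / 2) *\<^sub>R d + t *\<^sub>R perp d) = R" if "t\<^sup>2 = s\<^sup>2" for t
  proof -
    have "(norm ((1 / 2) *\<^sub>R d + t *\<^sub>R perp d))\<^sup>2 = R\<^sup>2"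
      using that assms by (simp add: norm_add_perp s power_divide)
    then show ?thesis using R by (simp add: power2_eq_iff_nonneg)
  qed
  have "perp d \<noteq> 0" using assms inner_perp_perp[of d] by (metis inner_eq_zero_iff)
  show ?thesis
  proof (rule that[OF n[of s] n[of "- s"]])
    show "(1 / 2) *\<^sub>R d + s *\<^sub>R perp d + ((1 / 2) *\<^sub>R d + (- s) *\<^sub>R perp d) = d"
      by (simp add: vec_eq_iff)
    have "s *\<^sub>R perp d \<noteq> (- s) *\<^sub>R perp d"
      using s \<open>perp d \<noteq> 0\<close> by (simp only: scaleR_right_imp_eq scaleR_cancel_right) simp
    then show "(1 / 2) *\<^sub>R d + s *\<^sub>R perp d \<noteq> (1 / 2) *\<^sub>R d + (- s) *\<^sub>R perp d" by simp
  qed auto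
qed

text \<open>The last assumption excludes \<open>norm (h - 2 *\<^sub>R a) = R\<close>, where the triangle degenerates because
  one of the two new vertices coincides with \<open>a\<close>.\<close>

lemma triangle_through_vertex:
  fixes P N a :: "real ^ 2"
  defines "h \<equiv> 2 *\<^sub>R (N - P)"
  assumes "R > 0" "norm a = R" "h \<noteq> a" "norm (h - a) < 2 * R" "norm (h - 2 *\<^sub>R a) \<noteq> R"
  obtains T where "T \<in> triangles_with (sphere P R) (sphere N (R / 2))" "P + a \<in> T"
proof -
  obtain b c where bc: "norm b = R" "norm c = R" "b + c = h - a" "b \<noteq> c"
    using chord_with_sum[of "h - a" R] assms by auto
  have ne: "a \<noteq> b" "a \<noteq> c"
  proof -
    have "c = h - 2 *\<^sub>R a" if "a = b"
      using bc(3) that by (simp add: algebra_simps scaleR_2)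
    moreover have "b = h - 2 *\<^sub>R a" if "a = c"
      using bc(3) that by (simp add: algebra_simps scaleR_2)
    ultimately show "a \<noteq> b" "a \<noteq> c" using bc assms by auto
  qed
  have sum: "a + b + c = 2 *\<^sub>R (N - P)" using bc(3) by (simp add: h_def algebra_simps)
  define T where "T = {P + a, P + b, P + c}"
  have "triangle T"
    unfolding triangle_def T_def using ne bc assms
    by (intro conjI not_collinear_sphere[of P _ R]) (auto simp: dist_norm)
  moreover have "is_circumcircle (sphere P R) T"
    using assms bc by (auto simp: is_circumcircle_def circle_def T_def dist_norm)
  moreover have "is_euler_circle (sphere N (R / 2)) T"
  proof -
    \<comment> \<open>The vector from the midpoint of a side to \<open>N\<close> is half the vector
      from \<open>P\<close> to the opposite vertex.\<close>
    have m: "dist N (midpoint (P + x) (P + y)) = R / 2"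
      if "x + y + z = 2 *\<^sub>R (N - P)" "norm z = R" for x y z
    proof -
      have "N - midpoint (P + x) (P + y) = (1 / 2) *\<^sub>R (2 *\<^sub>R (N - P) - (x + y))"
        by (simp add: midpoint_def vec_eq_iff field_simps)
      also have "2 *\<^sub>R (N - P) - (x + y) = z"
        using that(1) by (metis add_diff_cancel_left')
      finally have "N - midpoint (P + x) (P + y) = (1 / 2) *\<^sub>R z" .
      then show ?thesis using that(2) by (simp add: dist_norm)
    qed
    have "dist N (midpoint (P + a) (P + b)) = R / 2" "dist N (midpoint (P + a) (P + c)) = R / 2"
      "dist N (midpoint (P + b) (P + c)) = R / 2"
      by (rule m[of _ _ c] m[of _ _ b] m[of _ _ a]; use sum assms bc in \<open>simp add: ac_simps\<close>)+
    moreover have "circle (sphere N (R / 2))" unfolding circle_def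
      using assms(2) by (intro exI[of _ N] exI[of _ "R / 2"]) auto
    ultimately show ?thesis
      by (auto simp: is_euler_circle_def T_def midpoint_sym[of "P + b" "P + a"]
          midpoint_sym[of "P + c" "P + a"] midpoint_sym[of "P + c" "P + b"])
  qed
  ultimately show ?thesis using that[of T] by (simp add: triangles_with_def T_def)
qed

text \<open>Parametrise \<open>a\<close> by the cosine \<open>x\<close> of its angle with
  \<open>h\<close>. Then \<open>norm (h - a) < 2 * R\<close> becomes a lower bound on
  \<open>x\<close>, and \<open>norm (h - 2 *\<^sub>R a) = R\<close> a linear equation with at most
  one solution; these give \<open>x0\<close> and \<open>x1\<close>. The maximum with 0 in
  \<open>x0\<close> keeps \<open>x\<close> positive, so that \<open>x < 1\<close> yields
  \<open>x\<^sup>2 < 1\<close>.\<close>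

lemma infinite_good_vertices:
  fixes h :: "real ^ 2"
  assumes R: "R > 0" and h: "norm h < 3 * R"
  shows "infinite {a. norm a = R \<and> h \<noteq> a \<and> norm (h - a) < 2 * R \<and> norm (h - 2 *\<^sub>R a) \<noteq> R}"
    (is "infinite ?G")
proof -
  define k where "k = norm h"
  have k: "0 \<le> k" "k < 3 * R" using h by (simp_all add: k_def)
  obtain e :: "real ^ 2" where e: "norm e = 1" "h = k *\<^sub>R e"
  proof (cases "h = 0")
    case True
    then show ?thesis using that[of "axis 1 1"] by (simp add: k_def)
  next
    case False
    then show ?thesis using that[of "h /\<^sub>R k"] by (simp add: k_def)
  qed
  text \<open>If \<open>k = 0\<close> the quotients below are \<open>0\<close>, and any value would do.\<close>
  define x0 where "x0 = max 0 ((k\<^sup>2 - 3 * R\<^sup>2) / (2 * k * R))"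
  define x1 where "x1 = (k\<^sup>2 + 3 * R\<^sup>2) / (4 * k * R)"
  define a where "a x = (R * x) *\<^sub>R e + (R * sqrt (1 - x\<^sup>2)) *\<^sub>R perp e" for x
  have "x0 < 1"
  proof (cases "k = 0")
    case False
    \<comment> \<open>Here \<open>norm h < 3 * R\<close> enters: the product expands to
      \<open>2 * k * R - (k\<^sup>2 - 3 * R\<^sup>2)\<close>.\<close>
    have "(3 * R - k) * (k + R) > 0" using k R by simp
    then have "k\<^sup>2 - 3 * R\<^sup>2 < 2 * k * R" by (simp add: algebra_simps power2_eq_square)
    then show ?thesis using False k R by (simp add: x0_def)
  qed (simp add: x0_def)
  then have inf: "infinite ({x0<..<1} - {x1})" by (simp add: infinite_Ioo)
  have ea: "e \<bullet> a x = R * x" for x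
    using e by (simp add: a_def inner_simps flip: power2_norm_eq_inner)
  have inj: "inj_on a ({x0<..<1} - {x1})"
  proof (rule inj_onI)
    fix x y assume "a x = a y"
    then have "R * x = R * y" by (metis ea)
    then show "x = y" using R by simp
  qed
  have "a x \<in> ?G" if x: "x \<in> {x0<..<1}" "x \<noteq> x1" for x
  proof -
    have x01: "0 < x" "x < 1" using x by (auto simp: x0_def)
    then have "x\<^sup>2 < 1" by (simp add: power_less_one_iff abs_square_less_1)
    then have "(norm (a x))\<^sup>2 = R\<^sup>2"
      unfolding a_def norm_add_perp by (simp add: e power_mult_distrib algebra_simps)
    then have na: "norm (a x) = R" using R by (simp add: power2_eq_iff_nonneg)
    have ha: "h \<bullet> a x = k * R * x" using ea[of x] by (simp add: e(2))
    have n: "(norm (h - t *\<^sub>R a x))\<^sup>2 = k\<^sup>2 - 2 * t * (k * R * x) + t\<^sup>2 * R\<^sup>2" for t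
    proof -
      have "(norm (h - t *\<^sub>R a x))\<^sup>2 = h \<bullet> h - 2 * t * (h \<bullet> a x) + t\<^sup>2 * (a x \<bullet> a x)"
        unfolding power2_norm_eq_inner
        by (simp add: inner_simps inner_commute power2_eq_square algebra_simps)
      then show ?thesis by (simp add: ha k_def na flip: power2_norm_eq_inner)
    qed
    have "h \<noteq> a x"
    \<comment> \<open>Equality would force the cosine \<open>x\<close> to be 1.\<close>
    proof
      assume that: "h = a x"
      have "k = R" using that na by (simp add: k_def)
      moreover have "R * R = k * R * x"
        using ha that na by (simp add: power2_eq_square flip: power2_norm_eq_inner)
      ultimately show False using R x01 by simp
    qed
    moreover have "norm (h - a x) < 2 * R"
    proof -
      have "k\<^sup>2 - 3 * R\<^sup>2 < 2 * k * R * x"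
      proof (cases "k = 0")
        case False
        then have "(k\<^sup>2 - 3 * R\<^sup>2) / (2 * k * R) < x" "2 * k * R > 0"
          using x k R by (auto simp: x0_def)
        then show ?thesis by (simp add: divide_less_eq mult.commute)
      qed (use R in simp)
      then have "(norm (h - a x))\<^sup>2 < (2 * R)\<^sup>2"
        using n[of 1] by (simp add: power_mult_distrib)
      then show ?thesis by (rule power_less_imp_less_base) (use R in simp)
    qed
    moreover have "norm (h - 2 *\<^sub>R a x) \<noteq> R"
    proof
      assume that: "norm (h - 2 *\<^sub>R a x) = R"
      have eq: "4 * k * R * x = k\<^sup>2 + 3 * R\<^sup>2" using n[of 2] that by simp
      have "k \<noteq> 0" using eq R by auto
      then show False using x(2) eq R by (simp add: x1_def field_simps)
    qed
    ultimately show ?thesis using na by simp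
  qed
  then have "a ` ({x0<..<1} - {x1}) \<subseteq> ?G" by blast
  then show ?thesis using inf inj by (meson finite_imageD finite_subset)
qed

text \<open>Finitely many triangles have only finitely many vertices in total, yet each of the
  infinitely many good positions is a vertex of some triangle.\<close>

lemma infinite_triangles_with:
  assumes R: "R > 0" and "dist P N < 3 / 2 * R"
  shows "infinite (triangles_with (sphere P R) (sphere N (R / 2)))" (is "infinite ?S")
proof
  assume fin: "finite ?S"
  define h where "h = 2 *\<^sub>R (N - P)"
  define G where "G = {a. norm a = R \<and> h \<noteq> a \<and> norm (h - a) < 2 * R \<and> norm (h - 2 *\<^sub>R a) \<noteq> R}"
  have "norm h < 3 * R" using assms by (simp add: h_def dist_norm norm_minus_commute)
  then have inf: "infinite G" unfolding G_def by (rule infinite_good_vertices[OF R])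
  have "finite T" if "T \<in> ?S" for T
    using that by (auto simp: triangles_with_def triangle_def intro: card_ge_0_finite)
  then have "finite (\<Union> ?S)" using fin by blast
  moreover have "(+) P ` G \<subseteq> \<Union> ?S"
  proof
    fix y assume "y \<in> (+) P ` G"
    then obtain a where "y = P + a" "a \<in> G" by auto
    then show "y \<in> \<Union> ?S"
      using triangle_through_vertex[of R a N P] R unfolding G_def h_def by blast
  qed
  ultimately have "finite ((+) P ` G)" by (rule rev_finite_subset)
  then show False using inf by (simp add: finite_image_iff)
qed

section \<open>Infinitude and the type of the triangles\<close>

theorem theorem3:
  fixes O' N :: "real ^ 2" and R :: real
  assumes "R > 0"
    and "0 \<le> dist O' N" and "dist O' N < 3 / 2 * R"
  shows "infinite (triangles_with (sphere O' R) (sphere N (R / 2))) \<and>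
    (dist O' N < R / 2 \<longrightarrow>
       (\<forall>T \<in> triangles_with (sphere O' R) (sphere N (R / 2)). acute_triangle T)) \<and>
    (dist O' N = R / 2 \<longrightarrow>
       (\<forall>T \<in> triangles_with (sphere O' R) (sphere N (R / 2)). right_triangle T)) \<and>
    (dist O' N > R / 2 \<longrightarrow>
       (\<forall>T \<in> triangles_with (sphere O' R) (sphere N (R / 2)). obtuse_triangle T))"
proof (intro conjI impI ballI)
  let ?S = "triangles_with (sphere O' R) (sphere N (R / 2))"
  show "infinite ?S" using assms by (intro infinite_triangles_with)
  fix T assume T: "T \<in> ?S"
  then have tri: "triangle T" by (simp add: triangles_with_def)
  define p where "p A B C = (B - A) \<bullet> (C - A)" for A B C :: point
  have sign: "sgn ((R / 2)\<^sup>2 - (dist O' N)\<^sup>2) = sgn (p A B C * p B A C * p C A B)"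
    if "T = {A, B, C}" "A \<noteq> B" "A \<noteq> C" "B \<noteq> C" for A B C
    unfolding p_def using sgn_triangles_with[OF T that \<open>R > 0\<close>] .
  \<comment> \<open>Each \<open>p\<close> has the sign of the cosine at its first argument. Two of
    them add up to a squared side, so at most one is not positive; a positive product therefore
    makes all three positive.\<close>
  have pos: "p A B C + p B A C > 0" "p A B C + p C A B > 0" "p B A C + p C A B > 0"
    if "A \<noteq> B" "A \<noteq> C" "B \<noteq> C" for A B C
  proof -
    have "p A B C + p B A C = (norm (A - B))\<^sup>2" "p A B C + p C A B = (norm (A - C))\<^sup>2"
      "p B A C + p C A B = (norm (B - C))\<^sup>2"
      by (simp_all add: p_def power2_norm_eq_inner inner_simps inner_commute)
    then show "p A B C + p B A C > 0" "p A B C + p C A B > 0" "p B A C + p C A B > 0"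
      using that by simp_all
  qed
  obtain A B C where ABC: "T = {A, B, C}" "A \<noteq> B" "A \<noteq> C" "B \<noteq> C"
    using tri by (auto simp: triangle_def card_3_iff)
  note angles = interior_angles_insert3[OF ABC(2-4)]
  {
    assume "dist O' N < R / 2"
    then have less: "(dist O' N)\<^sup>2 < (R / 2)\<^sup>2" by (rule power_strict_mono) auto
    have "\<alpha> < pi / 2" if \<alpha>: "\<alpha> \<in> interior_angles T" for \<alpha>
    proof -
      obtain A B C where *: "\<alpha> = angle_at B A C" "A \<in> T" "B \<in> T" "C \<in> T"
        and ne: "A \<noteq> B" "A \<noteq> C" "B \<noteq> C"
        using \<alpha> by (auto simp: interior_angles_def)
      \<comment> \<open>The vertices naming an arbitrary angle exhaust \<open>T\<close> by
        cardinality, so only the angle at the first vertex needs checking.\<close>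
      have T_eq: "T = {A, B, C}"
        using tri * ne by (intro card_subset_eq[symmetric]) (auto simp: triangle_def intro: card_ge_0_finite)
      have "p A B C * p B A C * p C A B > 0"
        using sign[OF T_eq ne] less by (simp add: sgn_if split: if_splits)
      then have "p A B C > 0" using pos[OF ne] by (auto simp: zero_less_mult_iff)
      then show ?thesis using angle_at_less[of B A C] *(1) ne by (simp add: p_def)
    qed
    then show "acute_triangle T" using tri by (simp add: acute_triangle_def)
  }
  {
    assume "dist O' N = R / 2"
    then have "sgn (p A B C * p B A C * p C A B) = 0"
      using sign[OF ABC] by (metis diff_self sgn_0)
    then have "p A B C * p B A C * p C A B = 0" by (simp only: sgn_zero_iff)
    then have "\<exists>\<alpha>\<in>interior_angles T. \<alpha> = pi / 2"
      using angles angle_at_eq ABC unfolding p_def mult_eq_0_iff by metis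
    then show "right_triangle T" using tri by (simp add: right_triangle_def)
  }
  {
    assume "dist O' N > R / 2"
    then have "(R / 2)\<^sup>2 < (dist O' N)\<^sup>2" using \<open>R > 0\<close> by (intro power_strict_mono) auto
    then have "sgn ((R / 2)\<^sup>2 - (dist O' N)\<^sup>2) < 0" by (simp only: sgn_less diff_less_0_iff_less)
    then have "p A B C * p B A C * p C A B < 0" by (simp only: sign[OF ABC] sgn_less)
    then have "p A B C < 0 \<or> p B A C < 0 \<or> p C A B < 0"
      by (auto simp: mult_less_0_iff)
    then have "\<exists>\<alpha>\<in>interior_angles T. \<alpha> > pi / 2"
      using angles angle_at_greater ABC unfolding p_def by metis
    then show "obtuse_triangle T" using tri by (simp add: obtuse_triangle_def)
  }
qed

end
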